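(* Let $X$ and $Y$ be Banach spaces, let $W$ be a separable subspace of $\mathcal{L}(X,Y)$, let $Q$ be a closed and bounded subset of $X$, and let $G\subseteq \operatorname{Int} Q$. Then there is a residual subset $\mathcal{F}$ of $\operatorname{Lip}_1(Q,Y)$ such that for every $f\in\mathcal{F}$ the set $$\mathcal{N}_{f,W}:=\{x\in G : \mathcal{D}_f(x)\supseteq \mathbb{B}_W\}$$ is residual in $G$.
   Context: $\mathcal{L}(X,Y)$ is the space of bounded linear operators $X\to Y$ with the operator norm. $\mathbb{B}_W$ is the closed unit ball of $W$ (with respect to the operator norm). $\operatorname{Int} Q$ is the interior of $Q$ in $X$. $\operatorname{Lip}_1(Q,Y)$ is the set of all Lipschitz mappings $f:Q\to Y$ with Lipschitz constant $\operatorname{Lip}(f)\le 1$, equipped with the (complete) metric $\rho(f,g)=\sup\{\|f(x)-g(x)\|_Y : x\in Q\}$. For $f:Q\to Y$ and $x\in\operatorname{Int}Q$, $$\mathcal{D}_f(x):=\Big\{L\in\mathcal{L}(X,Y) : \liminf_{r\to0+}\ \sup_{u\in\overline{B}_X(0_X,r)}\frac{\|f(x+u)-f(x)-Lu\|_Y}{r}=0\Big\},$$ where $\overline{B}_X(0_X,r)$ is the closed ball in $X$ with centre the origin $0_X$ and radius $r$ (only small $r$ with $x+\overline{B}_X(0_X,r)\subseteq Q$ are relevant). A subset of a topological space is residual if its complement is of first Baire category (meagre) in that space; "residual in $G$" means residual in $G$ with the subspace topology inherited from $X$. *)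

theory Defs
  imports "HOL-Analysis.Analysis"
begin

definition nowhere_dense_in :: "'a topology \<Rightarrow> 'a set \<Rightarrow> bool" where
  "nowhere_dense_in T A \<longleftrightarrow> A \<subseteq> topspace T \<and> T interior_of (T closure_of A) = {}"

definition meagre_in :: "'a topology \<Rightarrow> 'a set \<Rightarrow> bool" where
  "meagre_in T A \<longleftrightarrow> (\<exists>\<A>. countable \<A> \<and> (\<forall>N\<in>\<A>. nowhere_dense_in T N) \<and> A = \<Union>\<A>)"

definition residual_in :: "'a topology \<Rightarrow> 'a set \<Rightarrow> bool" where
  "residual_in T A \<longleftrightarrow> A \<subseteq> topspace T \<and> meagre_in T (topspace T - A)"

text \<open>
  A map \<open>Q \<rightarrow> Y\<close> is encoded as a total function that is extensional on \<open>Q\<close>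
  (it takes the value \<open>undefined\<close> outside \<open>Q\<close>), so that maps on \<open>Q\<close> correspond to
  exactly one element of the carrier.
\<close>

definition Lip1 :: "'a::metric_space set \<Rightarrow> ('a \<Rightarrow> 'b::metric_space) set" where
  "Lip1 Q = {f \<in> extensional Q. 1-lipschitz_on Q f}"

text \<open>
  The locale \<open>Metric_space\<close> wants a nonnegative symmetric function on the whole type, hence the
  value \<open>0\<close> outside the carrier. For \<open>Q = {}\<close> the carrier is a singleton and the supremum,
  taken in the nonnegative reals, is \<open>0\<close>. For bounded \<open>Q\<close> the set of reals in the first branch
  is bounded above.
\<close>

definition Lip1_dist ::
    "'a::real_normed_vector set \<Rightarrow> ('a \<Rightarrow> 'b::real_normed_vector) \<Rightarrow> ('a \<Rightarrow> 'b) \<Rightarrow> real" where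
  "Lip1_dist Q f g =
     (if f \<in> Lip1 Q \<and> g \<in> Lip1 Q \<and> Q \<noteq> {} then SUP x\<in>Q. norm (f x - g x) else 0)"

definition Lip1_topology ::
    "'a::real_normed_vector set \<Rightarrow> ('a \<Rightarrow> 'b::real_normed_vector) topology" where
  "Lip1_topology Q = Metric_space.mtopology (Lip1 Q) (Lip1_dist Q)"

lemma Lip1_bdd_above:
  fixes f g :: "'a::real_normed_vector \<Rightarrow> 'b::real_normed_vector"
  assumes "bounded Q" "f \<in> Lip1 Q" "g \<in> Lip1 Q"
  shows "bdd_above ((\<lambda>x. norm (f x - g x)) ` Q)"
proof (cases "Q = {}")
  case False
  then obtain a where a: "a \<in> Q" by blast
  obtain B where B: "\<And>x. x \<in> Q \<Longrightarrow> dist a x \<le> B"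
    using assms(1) bounded_any_center[of Q a] by blast
  have "norm (f x - g x) \<le> norm (f a - g a) + 2 * B" if "x \<in> Q" for x
  proof -
    have "dist (f a) (f x) \<le> 1 * dist a x" "dist (g a) (g x) \<le> 1 * dist a x"
      using assms(2,3) a that unfolding Lip1_def by (auto dest: lipschitz_onD)
    moreover have "dist (f x) (g x) \<le> dist (f a) (f x) + dist (f a) (g a) + dist (g a) (g x)"
      by metric
    ultimately show ?thesis
      using B[OF that] by (simp add: dist_norm)
  qed
  then show ?thesis by (rule bdd_aboveI2)
qed simp

lemma Metric_space_Lip1:
  fixes Q :: "'a::real_normed_vector set"
  assumes "bounded Q"
  shows "Metric_space (Lip1 Q :: ('a \<Rightarrow> 'b::real_normed_vector) set) (Lip1_dist Q)"
proof
  fix f g h :: "'a \<Rightarrow> 'b"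
  have le: "norm (u x - v x) \<le> Lip1_dist Q u v" if "u \<in> Lip1 Q" "v \<in> Lip1 Q" "x \<in> Q" for u v x
    using cSUP_upper[OF that(3) Lip1_bdd_above[OF assms that(1,2)]] that
    unfolding Lip1_dist_def by auto
  show "0 \<le> Lip1_dist Q f g"
  proof (cases "f \<in> Lip1 Q \<and> g \<in> Lip1 Q \<and> Q \<noteq> {}")
    case True
    then obtain x where "x \<in> Q" by blast
    with le[of f g x] True show ?thesis
      using norm_ge_zero order_trans by blast
  qed (auto simp: Lip1_dist_def)
  show "Lip1_dist Q f g = Lip1_dist Q g f"
    by (auto simp: Lip1_dist_def norm_minus_commute)
  assume f: "f \<in> Lip1 Q" and g: "g \<in> Lip1 Q"
  show "Lip1_dist Q f g = 0 \<longleftrightarrow> f = g"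
  proof
    assume 0: "Lip1_dist Q f g = 0"
    have "f x = g x" if "x \<in> Q" for x
      using le[OF f g that] 0 by simp
    with f g show "f = g"
      unfolding Lip1_def by (auto intro: extensionalityI)
  qed (auto simp: Lip1_dist_def)
  assume h: "h \<in> Lip1 Q"
  show "Lip1_dist Q f h \<le> Lip1_dist Q f g + Lip1_dist Q g h"
  proof (cases "Q = {}")
    case False
    have "norm (f x - h x) \<le> Lip1_dist Q f g + Lip1_dist Q g h" if "x \<in> Q" for x
      using le[OF f g that] le[OF g h that] norm_triangle_ineq[of "f x - g x" "g x - h x"] by simp
    then have "(SUP x\<in>Q. norm (f x - h x)) \<le> Lip1_dist Q f g + Lip1_dist Q g h"
      using False by (intro cSUP_least)
    then show ?thesis using f h False by (simp add: Lip1_dist_def)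
  qed (simp add: Lip1_dist_def)
qed

text \<open>
  The set \<open>\<D>\<^sub>f(x)\<close> is used only at interior points \<open>x\<close> of the domain of \<open>f\<close>. There the values of
  \<open>f\<close> outside its domain are irrelevant, since the limit inferior depends only on small \<open>r\<close>.
\<close>

definition diff_ops ::
    "('a::real_normed_vector \<Rightarrow> 'b::real_normed_vector) \<Rightarrow> 'a \<Rightarrow> ('a \<Rightarrow>\<^sub>L 'b) set" where
  "diff_ops f x =
     {L. Liminf (at_right (0::real))
           (\<lambda>r. SUP u\<in>cball 0 r. ereal (norm (f (x + u) - f x - blinfun_apply L u) / r)) = 0}"

definition N_set ::
    "'a::real_normed_vector set \<Rightarrow> ('a \<Rightarrow> 'b::real_normed_vector) \<Rightarrow> ('a \<Rightarrow>\<^sub>L 'b) set \<Rightarrow> 'a set" where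
  "N_set G f W = {x \<in> G. {L \<in> W. norm L \<le> 1} \<subseteq> diff_ops f x}"

end

theory Submission
  imports Defs
begin

text \<open>
  The inclusion of the unit ball of \<open>W\<close> in \<open>\<D>\<^sub>f(x)\<close> reduces to countably many conditions: for a
  countable dense set of operators \<open>L\<close> in that ball and for arbitrarily small \<open>\<epsilon>\<close>, the map \<open>f\<close>
  is within \<open>\<epsilon> r\<close> of an affine map with linear part \<open>L\<close> on \<open>cball x r\<close>, for some \<open>r < \<epsilon>\<close>. Such an
  approximation survives, with a worse constant, a small change of \<open>x\<close>, of \<open>f\<close> or of \<open>L\<close>, so each
  condition describes a set with large interior, and only density is at stake.

  Since \<open>G\<close> may be nonseparable, no countable set of points \<open>x\<close> suffices. Instead, for each \<open>m\<close>, let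
  \<open>D m\<close> be a maximal \<open>1/(m+1)\<close>-separated set of points of \<open>G\<close> whose distance to the complement of \<open>Q\<close> is
  bounded below in terms of \<open>m\<close>. The union of the \<open>D m\<close> is dense in \<open>G\<close>, and all
  points of one \<open>D m\<close> are treated at once, with a common scale \<open>\<delta>\<close>: the maps that are nearly affine with
  linear part \<open>L\<close> at scale \<open>\<delta>\<close> at every point of \<open>D m\<close> contain a dense open set
  (\<open>affine_on_scale_dense\<close>). A map in the intersection of these countably many sets satisfies each
  condition near every point of a dense subset of \<open>G\<close>.

  Density rests on \<open>lipschitz_make_affine_near\<close>: every 1-Lipschitz map has a uniformly close
  \<open>(1 + \<eta>)\<close>-Lipschitz modification that is affine with linear part \<open>L\<close> near every point of a separated
  set. Around one point \<open>d\<close>, one interpolates between \<open>f\<close> and \<open>x \<mapsto> f d + L (x - d)\<close>. These differ by at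
  most \<open>2 s\<close> at distance \<open>s\<close> from \<open>d\<close>, so the interpolation costs little if the slope of the
  weight at distance \<open>s\<close> is at most \<open>c / s\<close> with small \<open>c\<close>; a logarithm drops from 1 to 0 at this
  rate, however small \<open>c\<close> is, on a sufficiently long range of scales. Dividing by \<open>1 + \<eta>\<close> returns
  to the space of 1-Lipschitz maps.
\<close>

section \<open>Residual sets and countable dense subsets\<close>

text \<open>
  The complement of \<open>A\<close> is covered by the closed nowhere dense complements of the sets in \<open>\<U>\<close>; cutting
  these down to the complement of \<open>A\<close> makes the union exact.
\<close>

lemma residual_inI:
  assumes "countable \<U>"
    and "\<And>U. U \<in> \<U> \<Longrightarrow> openin T U"
    and "\<And>U. U \<in> \<U> \<Longrightarrow> T closure_of U = topspace T"
    and "A \<subseteq> topspace T"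
    and "topspace T \<inter> \<Inter>\<U> \<subseteq> A"
  shows "residual_in T A"
proof -
  define \<A> where "\<A> = (\<lambda>U. (topspace T - U) - A) ` \<U>"
  have "nowhere_dense_in T N" if "N \<in> \<A>" for N
  proof -
    obtain U where U: "U \<in> \<U>" and N: "N = (topspace T - U) - A"
      using \<open>N \<in> \<A>\<close> by (auto simp: \<A>_def)
    have "T closure_of N \<subseteq> topspace T - U"
      using assms(2)[OF U] by (intro closure_of_minimal) (auto simp: N)
    then have "T interior_of (T closure_of N) \<subseteq> T interior_of (topspace T - U)"
      by (rule interior_of_mono)
    also have "\<dots> = {}"
      using assms(3)[OF U] by (simp add: interior_of_complement)
    finally show ?thesis
      by (auto simp: nowhere_dense_in_def N)
  qed
  moreover have "topspace T - A = \<Union>\<A>"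
    using assms(5) by (auto simp: \<A>_def)
  moreover have "countable \<A>"
    using assms(1) by (simp add: \<A>_def)
  ultimately show ?thesis
    using assms(4) unfolding residual_in_def meagre_in_def by blast
qed

text \<open>
  Separability of a metric space passes to arbitrary subsets. A dense set of the whole space may
  miss the subset, so each of its points is replaced, at every scale, by a nearby point of the subset.
\<close>

lemma separable_space_countable_dense_subset:
  fixes B W :: "'a::metric_space set"
  assumes "separable_space (top_of_set W)" and "B \<subseteq> W"
  obtains S where "countable S" "S \<subseteq> B" "\<And>x e. x \<in> B \<Longrightarrow> 0 < e \<Longrightarrow> \<exists>y\<in>S. dist x y < e"
proof -
  obtain C where C: "countable C" "C \<subseteq> W" and eq: "top_of_set W closure_of C = W"
    using assms(1) unfolding separable_space_def by auto
  have "W \<inter> closure C = W"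
    using eq C(2) by (simp only: closure_of_subtopology Int_absorb1 euclidean_closure_of)
  then have dense: "W \<subseteq> closure C" by blast
  define I where "I = {(c, k). c \<in> C \<and> (\<exists>b\<in>B. dist b c < inverse (real (Suc k)))}"
  define pick where "pick = (\<lambda>(c, k). SOME b. b \<in> B \<and> dist b c < inverse (real (Suc k)))"
  have pick: "pick (c, k) \<in> B \<and> dist (pick (c, k)) c < inverse (real (Suc k))" if "(c, k) \<in> I" for c k
  proof -
    have "\<exists>b. b \<in> B \<and> dist b c < inverse (real (Suc k))" using that by (auto simp: I_def)
    from someI_ex[OF this] show ?thesis by (simp add: pick_def)
  qed
  show thesis
  proof
    have "I \<subseteq> C \<times> UNIV" by (auto simp: I_def)
    moreover have "countable (C \<times> (UNIV :: nat set))" using C(1) by simp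
    ultimately show "countable (pick ` I)"
      using countable_subset countable_image by blast
    show "pick ` I \<subseteq> B" using pick by auto
    fix x and e :: real assume x: "x \<in> B" and "0 < e"
    obtain k where k: "inverse (real (Suc k)) < e / 2"
      using reals_Archimedean[of "e / 2"] \<open>0 < e\<close> by auto
    have "x \<in> closure C" using x assms(2) dense by blast
    moreover have "0 < inverse (real (Suc k))" by simp
    ultimately obtain c where c: "c \<in> C" "dist c x < inverse (real (Suc k))"
      unfolding closure_approachable by blast
    have "(c, k) \<in> I" using c x unfolding I_def by (auto simp: dist_commute)
    then have "dist (pick (c, k)) c < inverse (real (Suc k))" "pick (c, k) \<in> pick ` I"
      using pick by auto
    moreover have "dist x (pick (c, k)) \<le> dist c x + dist (pick (c, k)) c" by metric
    ultimately show "\<exists>y\<in>pick ` I. dist x y < e"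
      using c k by (intro bexI[of _ "pick (c, k)"]) auto
  qed
qed

lemma maximal_separated_subset:
  fixes A :: "'a::metric_space set"
  assumes "0 < e"
  obtains D where "D \<subseteq> A" "pairwise (\<lambda>x y. e \<le> dist x y) D" "\<And>x. x \<in> A \<Longrightarrow> \<exists>d\<in>D. dist x d < e"
proof -
  let ?P = "{D. D \<subseteq> A \<and> pairwise (\<lambda>x y. e \<le> dist x y) D}"
  have "\<exists>M\<in>?P. \<forall>X\<in>?P. M \<subseteq> X \<longrightarrow> X = M"
  proof (rule subset_Zorn')
    fix \<C> assume \<C>: "subset.chain ?P \<C>"
    have "e \<le> dist x y" if "x \<in> \<Union>\<C>" "y \<in> \<Union>\<C>" "x \<noteq> y" for x y
    proof -
      obtain X Y where XY: "X \<in> \<C>" "x \<in> X" "Y \<in> \<C>" "y \<in> Y"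
        using \<open>x \<in> \<Union>\<C>\<close> \<open>y \<in> \<Union>\<C>\<close> by blast
      then have "X \<subseteq> Y \<or> Y \<subseteq> X" using \<C> unfolding subset_chain_def by blast
      then obtain Z where Z: "Z \<in> \<C>" "x \<in> Z" "y \<in> Z" using XY by blast
      then have "pairwise (\<lambda>x y. e \<le> dist x y) Z" using \<C> unfolding subset_chain_def by blast
      then show ?thesis using Z \<open>x \<noteq> y\<close> by (simp add: pairwise_def)
    qed
    moreover have "\<Union>\<C> \<subseteq> A"
      using \<C> unfolding subset_chain_def by blast
    ultimately show "\<Union>\<C> \<in> ?P"
      by (simp add: pairwise_def)
  qed
  then obtain D where D: "D \<in> ?P" and max: "\<forall>X\<in>?P. D \<subseteq> X \<longrightarrow> X = D"
    by (rule bexE)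
  have "\<exists>d\<in>D. dist x d < e" if "x \<in> A" for x
  proof (rule ccontr)
    assume *: "\<not> ?thesis"
    then have far: "e \<le> dist x d" if "d \<in> D" for d using that by (simp add: not_less)
    have "insert x D \<in> ?P"
      using D that far by (simp add: pairwise_insert dist_commute[of _ x])
    from bspec[OF max this] have "insert x D = D" by (simp only: subset_insertI simp_thms)
    then have "x \<in> D" by blast
    from far[OF this] show False using \<open>0 < e\<close> by simp
  qed
  with D that show thesis by blast
qed

section \<open>Approximation by an affine map at a given scale\<close>

definition approx_affine ::
    "('a::real_normed_vector \<Rightarrow> 'b::real_normed_vector) \<Rightarrow> ('a \<Rightarrow>\<^sub>L 'b) \<Rightarrow> 'a \<Rightarrow> real \<Rightarrow> real \<Rightarrow> bool"
  where "approx_affine f L x r \<epsilon> \<longleftrightarrow>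
    (\<forall>u. norm u \<le> r \<longrightarrow> norm (f (x + u) - f x - blinfun_apply L u) \<le> \<epsilon> * r)"

lemma approx_affine_mono:
  assumes "approx_affine f L x r \<epsilon>" and "\<epsilon> \<le> \<epsilon>'" and "0 \<le> r"
  shows "approx_affine f L x r \<epsilon>'"
proof -
  have "\<epsilon> * r \<le> \<epsilon>' * r" using assms(2,3) by (rule mult_right_mono)
  with assms(1) show ?thesis unfolding approx_affine_def by (blast intro: order_trans)
qed

text \<open>
  The factor 4 consists of a 2 for using the estimate at \<open>x\<close> twice, once for each endpoint \<open>y + u\<close>
  and \<open>y\<close>, and a 2 because the error is now measured against \<open>r / 2\<close>. This is how
  a good point makes a whole ball of points good, up to constants.
\<close>

lemma approx_affine_shift:
  assumes "approx_affine f L x r \<epsilon>" and "norm (y - x) \<le> r / 2"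
  shows "approx_affine f L y (r / 2) (4 * \<epsilon>)"
  unfolding approx_affine_def
proof (intro allI impI)
  fix u :: 'a assume u: "norm u \<le> r / 2"
  have "norm (y - x + u) \<le> r" "norm (y - x) \<le> r"
    using assms(2) u norm_triangle_ineq[of "y - x" u] norm_ge_zero[of "y - x"] by linarith+
  then have a: "norm (f (x + (y - x + u)) - f x - L (y - x + u)) \<le> \<epsilon> * r"
      "norm (f (x + (y - x)) - f x - L (y - x)) \<le> \<epsilon> * r"
    using assms(1) unfolding approx_affine_def by blast+
  have "f (y + u) - f y - L u =
      (f (x + (y - x + u)) - f x - L (y - x + u)) - (f (x + (y - x)) - f x - L (y - x))"
    by (simp add: blinfun.add_right)
  then have "norm (f (y + u) - f y - L u) \<le> \<epsilon> * r + \<epsilon> * r"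
    by (simp only:) (rule order_trans[OF norm_triangle_ineq4 add_mono[OF a]])
  then show "norm (f (y + u) - f y - L u) \<le> 4 * \<epsilon> * (r / 2)" by simp
qed

lemma approx_affine_perturb:
  assumes "approx_affine f L x r \<epsilon>" and "\<And>z. z \<in> cball x r \<Longrightarrow> norm (f z - h z) \<le> \<epsilon> * r" and "0 < r"
  shows "approx_affine h L x r (3 * \<epsilon>)"
  unfolding approx_affine_def
proof (intro allI impI)
  fix u :: 'a assume u: "norm u \<le> r"
  have "h (x + u) - h x - L u =
      (f (x + u) - f x - L u) - (f (x + u) - h (x + u)) + (f x - h x)" by simp
  also have "norm \<dots> \<le> norm (f (x + u) - f x - L u) + norm (f (x + u) - h (x + u)) + norm (f x - h x)"
    by (intro order_trans[OF norm_triangle_ineq] add_right_mono norm_triangle_ineq4)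
  also have "\<dots> \<le> \<epsilon> * r + \<epsilon> * r + \<epsilon> * r"
    using assms u by (intro add_mono) (auto simp: approx_affine_def dist_norm)
  finally show "norm (h (x + u) - h x - L u) \<le> 3 * \<epsilon> * r" by simp
qed

lemma approx_affine_change_operator:
  assumes "approx_affine f L x r \<epsilon>" and "norm (L - L') \<le> \<epsilon>"
  shows "approx_affine f L' x r (2 * \<epsilon>)"
  unfolding approx_affine_def
proof (intro allI impI)
  fix u :: 'a assume u: "norm u \<le> r"
  have "norm ((L - L') u) \<le> norm (L - L') * norm u" by (rule norm_blinfun)
  also have "\<dots> \<le> \<epsilon> * r"
    using assms(2) u norm_ge_zero[of "L - L'"] by (intro mult_mono) (linarith | simp)+
  finally have "norm ((L - L') u) \<le> \<epsilon> * r" .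
  moreover have "norm (f (x + u) - f x - L u) \<le> \<epsilon> * r"
    using assms(1) u unfolding approx_affine_def by blast
  ultimately have "norm ((f (x + u) - f x - L u) + (L - L') u) \<le> 2 * \<epsilon> * r"
    using norm_triangle_ineq[of "f (x + u) - f x - L u" "(L - L') u"] by simp
  then show "norm (f (x + u) - f x - L' u) \<le> 2 * \<epsilon> * r"
    by (simp add: blinfun.diff_left)
qed

text \<open>
  The difference quotients are nonnegative, so the limit inferior is 0 as soon as they are arbitrarily
  small at some arbitrarily small radii.
\<close>

lemma diff_opsI:
  assumes "\<And>\<epsilon>. 0 < \<epsilon> \<Longrightarrow> \<exists>r. 0 < r \<and> r < \<epsilon> \<and> approx_affine f L x r \<epsilon>"
  shows "L \<in> diff_ops f x"
proof -
  let ?q = "\<lambda>r. SUP u\<in>cball 0 r. ereal (norm (f (x + u) - f x - blinfun_apply L u) / r)"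
  have "0 \<le> Liminf (at_right 0) ?q"
  proof (rule Liminf_bounded)
    have "0 \<le> ?q r" if "0 < r" for r :: real
      using that by (intro SUP_upper2[of 0]) auto
    then show "\<forall>\<^sub>F r in at_right 0. 0 \<le> ?q r"
      by (auto simp: eventually_at_right_field intro: exI[of _ 1])
  qed
  moreover have "Liminf (at_right 0) ?q \<le> 0"
  proof (rule ccontr)
    assume "\<not> ?thesis"
    then have "0 < Liminf (at_right 0) ?q" by (simp only: not_le)
    then obtain c where c: "0 < ereal c" "ereal c < Liminf (at_right 0) ?q"
      using ereal_dense2 by blast
    then obtain b where b: "0 < b" "\<And>r. 0 < r \<Longrightarrow> r < b \<Longrightarrow> ereal c < ?q r"
      using less_LiminfD[OF c(2)] by (auto simp: eventually_at_right_field)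
    have "0 < min b c" using b(1) c(1) by simp
    then obtain r where r: "0 < r" "r < min b c" "approx_affine f L x r (min b c)"
      using assms by blast
    have "?q r \<le> ereal c"
    proof (rule SUP_least)
      fix u :: 'a assume "u \<in> cball 0 r"
      then have "norm (f (x + u) - f x - L u) \<le> min b c * r"
        using r(3) by (simp add: approx_affine_def)
      also have "\<dots> \<le> c * r" using r(1) by (intro mult_right_mono) auto
      finally show "ereal (norm (f (x + u) - f x - L u) / r) \<le> ereal c"
        using r(1) by (simp add: divide_le_eq)
    qed
    moreover have "ereal c < ?q r" using r by (intro b(2)) auto
    ultimately show False by (meson leD)
  qed
  ultimately have "Liminf (at_right 0) ?q = 0" by (intro antisym)
  then show ?thesis unfolding diff_ops_def by blast
qed

section \<open>Making a Lipschitz map affine near the points of a separated set\<close>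

text \<open>
  The weight is 1 for \<open>0 < s \<le> R exp (-1/c)\<close> and 0 for \<open>s \<ge> R\<close>. Its value at \<open>s = 0\<close>, which is \<open>0\<close> because
  \<open>R / 0 = 0\<close> and \<open>ln 0 = 0\<close>, is harmless: it only ever multiplies a quantity that vanishes there.
\<close>

definition log_cutoff :: "real \<Rightarrow> real \<Rightarrow> real \<Rightarrow> real" where
  "log_cutoff c R s = max 0 (min 1 (c * ln (R / s)))"

lemma log_cutoff_bounds: "0 \<le> log_cutoff c R s" "log_cutoff c R s \<le> 1"
  by (auto simp: log_cutoff_def)

lemma log_cutoff_eq_0:
  assumes "0 < c" "0 < R" "R \<le> s"
  shows "log_cutoff c R s = 0"
proof -
  have "ln (R / s) \<le> 0" using assms by simp
  then have "c * ln (R / s) \<le> 0" using assms by (simp add: mult_le_0_iff)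
  then show ?thesis by (simp add: log_cutoff_def)
qed

lemma log_cutoff_eq_1:
  assumes "0 < c" "0 < R" "0 < s" "s \<le> R * exp (- 1 / c)"
  shows "log_cutoff c R s = 1"
proof -
  have "ln s \<le> ln (R * exp (- 1 / c))" using assms by (subst ln_le_cancel_iff) auto
  then have "1 / c \<le> ln (R / s)" using assms by (simp add: ln_mult ln_div)
  then have "1 \<le> c * ln (R / s)" using assms by (simp add: divide_le_eq mult.commute)
  then show ?thesis by (simp add: log_cutoff_def)
qed

text \<open>
  This is the bound \<open>c / s\<close> on the slope in integrated form: \<open>ln (s / t) \<le> s / t - 1\<close>. The factor is the
  smaller radius \<open>t\<close>, since \<open>ln (s / t) * s\<close> exceeds \<open>s - t\<close> for \<open>t < s\<close>.
\<close>

lemma log_cutoff_diff: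
  assumes "0 < c" "0 < R" "0 \<le> t" "t \<le> s"
  shows "\<bar>log_cutoff c R s - log_cutoff c R t\<bar> * t \<le> c * (s - t)"
proof (cases "t = 0")
  case False
  then have t: "0 < t" "0 < s" using assms by auto
  have "ln (s / t) \<le> s / t - 1" using t by (intro ln_le_minus_one) auto
  moreover have "0 \<le> ln (s / t)" using t assms by simp
  moreover have "\<bar>log_cutoff c R s - log_cutoff c R t\<bar> \<le> \<bar>c * ln (R / s) - c * ln (R / t)\<bar>"
    by (auto simp: log_cutoff_def)
  moreover have "c * ln (R / s) - c * ln (R / t) = - (c * ln (s / t))"
    using t assms by (simp add: ln_div algebra_simps)
  ultimately have "\<bar>log_cutoff c R s - log_cutoff c R t\<bar> \<le> c * (s / t - 1)"
    using assms(1) by (smt (verit) mult_left_mono mult_nonneg_nonneg)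
  then have "\<bar>log_cutoff c R s - log_cutoff c R t\<bar> * t \<le> c * (s / t - 1) * t"
    using t by (intro mult_right_mono) auto
  also have "\<dots> = c * (s - t)" using t by (simp add: field_simps)
  finally show ?thesis .
qed (use assms in auto)

text \<open>
  The correction that, added to \<open>f\<close>, interpolates between \<open>f\<close> and its affine replacement at \<open>d\<close>.
\<close>

definition affine_corr ::
    "real \<Rightarrow> real \<Rightarrow> ('a::real_normed_vector \<Rightarrow> 'b::real_normed_vector) \<Rightarrow> ('a \<Rightarrow>\<^sub>L 'b) \<Rightarrow> 'a \<Rightarrow> 'a \<Rightarrow> 'b"
  where "affine_corr c R f L d x =
    log_cutoff c R (norm (x - d)) *\<^sub>R (f d + blinfun_apply L (x - d) - f x)"

lemma lipschitz_diff_blinfun_bound: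
  fixes f :: "'a::real_normed_vector \<Rightarrow> 'b::real_normed_vector"
  assumes "1-lipschitz_on Q f" "norm L \<le> 1" "d \<in> Q" "x \<in> Q"
  shows "norm (f d + blinfun_apply L (x - d) - f x) \<le> 2 * norm (x - d)"
proof -
  have "norm (f d - f x) \<le> norm (x - d)"
    using lipschitz_onD[OF assms(1,3,4)] by (simp add: dist_norm norm_minus_commute)
  moreover have "norm (L (x - d)) \<le> norm (x - d)"
    using norm_blinfun[of L "x - d"] assms(2) mult_right_mono[of "norm L" 1 "norm (x - d)"] by simp
  ultimately have "norm ((f d - f x) + L (x - d)) \<le> 2 * norm (x - d)"
    using norm_triangle_ineq[of "f d - f x" "L (x - d)"] by linarith
  then show ?thesis by (simp add: algebra_simps)
qed

text \<open>
  An increment of the interpolated map is a convex combination of an increment of \<open>f\<close> and one of \<open>L\<close>,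
  both at most \<open>\<parallel>x - y\<parallel>\<close>, plus the change of the weight times the gap between \<open>f\<close> and its affine
  replacement. Evaluating that gap at the point nearer to \<open>d\<close> is what \<open>log_cutoff_diff\<close> requires; it is
  possible because the claim is symmetric in \<open>x\<close> and \<open>y\<close>.
\<close>

lemma lipschitz_add_affine_corr:
  fixes f :: "'a::real_normed_vector \<Rightarrow> 'b::real_normed_vector"
  assumes f: "1-lipschitz_on Q f" and L: "norm L \<le> 1" and "d \<in> Q" and "0 < c" "0 < R"
  shows "(1 + 2 * c)-lipschitz_on Q (\<lambda>x. f x + affine_corr c R f L d x)"
proof (rule lipschitz_onI)
  let ?g = "\<lambda>x. f x + affine_corr c R f L d x"
  have le: "dist (?g x) (?g y) \<le> (1 + 2 * c) * dist x y"
    if "x \<in> Q" "y \<in> Q" and yx: "norm (y - d) \<le> norm (x - d)" for x y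
  proof -
    define a b where "a = log_cutoff c R (norm (x - d))" and "b = log_cutoff c R (norm (y - d))"
    define p where "p = f d + L (y - d) - f y"
    have a: "0 \<le> a" "a \<le> 1" unfolding a_def by (rule log_cutoff_bounds)+
    have f': "norm (f x - f y) \<le> norm (x - y)"
      using lipschitz_onD[OF f that(1,2)] by (simp add: dist_norm)
    have L': "norm (L (x - y)) \<le> norm (x - y)"
      using norm_blinfun[of L "x - y"] L mult_right_mono[of "norm L" 1 "norm (x - y)"] by simp
    have "norm p \<le> 2 * norm (y - d)"
      unfolding p_def using f L \<open>d \<in> Q\<close> that(2) by (rule lipschitz_diff_blinfun_bound)
    then have "\<bar>a - b\<bar> * norm p \<le> 2 * (\<bar>a - b\<bar> * norm (y - d))"
      using mult_left_mono[of "norm p" "2 * norm (y - d)" "\<bar>a - b\<bar>"] by simp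
    also have "\<dots> \<le> 2 * (c * (norm (x - d) - norm (y - d)))"
      unfolding a_def b_def using \<open>0 < c\<close> \<open>0 < R\<close> yx by (intro mult_left_mono log_cutoff_diff) auto
    also have "\<dots> \<le> 2 * (c * norm (x - y))"
      using \<open>0 < c\<close> norm_triangle_ineq2[of "x - d" "y - d"] by (intro mult_left_mono) auto
    finally have p: "\<bar>a - b\<bar> * norm p \<le> 2 * (c * norm (x - y))" .
    have "?g x - ?g y = ((1 - a) *\<^sub>R (f x - f y) + a *\<^sub>R L (x - y)) + (a - b) *\<^sub>R p"
    proof -
      have "L (x - d) = L (x - y) + L (y - d)" by (simp flip: blinfun.add_right)
      then show ?thesis
        unfolding affine_corr_def a_def[symmetric] b_def[symmetric] p_def
        by (simp add: algebra_simps)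
    qed
    then have "norm (?g x - ?g y) \<le> (1 - a) * norm (f x - f y) + a * norm (L (x - y)) + \<bar>a - b\<bar> * norm p"
      using a norm_triangle_ineq[of "(1 - a) *\<^sub>R (f x - f y) + a *\<^sub>R L (x - y)" "(a - b) *\<^sub>R p"]
        norm_triangle_ineq[of "(1 - a) *\<^sub>R (f x - f y)" "a *\<^sub>R L (x - y)"] by simp
    also have "\<dots> \<le> (1 - a) * norm (x - y) + a * norm (x - y) + 2 * (c * norm (x - y))"
      using a f' L' p by (intro add_mono mult_left_mono) auto
    also have "\<dots> = (1 + 2 * c) * dist x y" by (simp add: dist_norm algebra_simps)
    finally show ?thesis by (simp add: dist_norm)
  qed
  fix x y assume "x \<in> Q" "y \<in> Q"
  then show "dist (?g x) (?g y) \<le> (1 + 2 * c) * dist x y"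
    using le[of x y] le[of y x] by (cases "norm (y - d) \<le> norm (x - d)") (auto simp: dist_commute)
qed (use \<open>0 < c\<close> in auto)

text \<open>
  The corrections at different points of \<open>D\<close> live on disjoint balls of radius \<open>R\<close>. Two points whose
  increment sees at most one correction are covered by \<open>lipschitz_add_affine_corr\<close>. Two points in
  different balls are at least \<open>\<sigma> / 2\<close> apart, while each correction has norm at most \<open>2 * R\<close>; with
  \<open>8 * R \<le> \<eta> * \<sigma>\<close> this is absorbed by \<open>\<eta>\<close>.
  Comparing the pair directly, rather than along a segment, is essential because \<open>Q\<close> may be nonconvex.
\<close>

lemma lipschitz_make_affine_near:
  fixes f :: "'a::real_normed_vector \<Rightarrow> 'b::real_normed_vector"
  assumes f: "1-lipschitz_on Q f" and L: "norm L \<le> 1"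
    and D: "D \<subseteq> Q" "pairwise (\<lambda>x y. \<sigma> \<le> dist x y) D" and "0 < \<sigma>" "0 < \<eta>"
  obtains g \<delta> where "(1 + \<eta>)-lipschitz_on Q g" "\<And>x. x \<in> Q \<Longrightarrow> norm (g x - f x) \<le> \<eta>" "0 < \<delta>"
    "\<And>d x. d \<in> D \<Longrightarrow> x \<in> Q \<Longrightarrow> norm (x - d) \<le> \<delta> \<Longrightarrow> g x = f d + blinfun_apply L (x - d)"
proof -
  define c where "c = \<eta> / 2"
  define R where "R = min (\<eta> / 2) (min (\<sigma> / 4) (\<eta> * \<sigma> / 8))"
  define h where "h = affine_corr c R f L"
  define \<delta> where "\<delta> = R * exp (- 1 / c)"
  have c: "0 < c" and R: "0 < R" "2 * R \<le> \<eta>" "4 * R \<le> \<sigma>" "8 * R \<le> \<eta> * \<sigma>"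
    using \<open>0 < \<eta>\<close> \<open>0 < \<sigma>\<close> by (auto simp: c_def R_def min_def)
  have \<delta>: "0 < \<delta>" "\<delta> < R" using c R by (auto simp: \<delta>_def)
  have single: "(1 + \<eta>)-lipschitz_on Q (\<lambda>x. f x + h d x)" if "d \<in> D" for d
  proof -
    have "d \<in> Q" using that D by blast
    from lipschitz_add_affine_corr[OF f L this c R(1)] show ?thesis by (simp add: h_def c_def)
  qed
  have h0: "h d x = 0" if "R \<le> norm (x - d)" for d x
    using that c R by (simp add: h_def affine_corr_def log_cutoff_eq_0)
  have hR: "norm (h d x) \<le> 2 * R" if "d \<in> D" "x \<in> Q" for d x
  proof (cases "norm (x - d) < R")
    case True
    have "norm (h d x) \<le> 1 * norm (f d + L (x - d) - f x)"
      unfolding h_def affine_corr_def norm_scaleR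
      by (intro mult_right_mono) (auto simp: log_cutoff_bounds abs_of_nonneg)
    also have "\<dots> \<le> 2 * norm (x - d)"
      using lipschitz_diff_blinfun_bound[OF f L, of d x] that D by auto
    finally show ?thesis using True by simp
  qed (use h0 R in auto)
  define near where "near x d \<longleftrightarrow> d \<in> D \<and> norm (x - d) < R" for x d
  have near_unique: "d = d'" if "near x d" "near x d'" for x d d'
  proof (rule ccontr)
    assume "d \<noteq> d'"
    then have "\<sigma> \<le> dist d d'" using that D(2) by (auto simp: near_def pairwise_def)
    also have "\<dots> \<le> norm (x - d) + norm (x - d')"
      by (metis dist_commute dist_norm dist_triangle2)
    finally show False using that R by (auto simp: near_def)
  qed
  define g where "g x = (if \<exists>d. near x d then f x + h (THE d. near x d) x else f x)" for x
  have g_near: "g x = f x + h d x" if "near x d" for x d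
  proof -
    have "(THE d. near x d) = d" using that near_unique by blast
    then show ?thesis using that by (auto simp: g_def)
  qed
  have g_far: "g x = f x" if "\<nexists>d. near x d" for x
    using that by (simp add: g_def)
  have g_only: "g x = f x + h d x" if "d \<in> D" "\<And>d'. near x d' \<Longrightarrow> d' = d" for d x
  proof (cases "near x d")
    case False
    then have "\<nexists>d. near x d" using that(2) by auto
    moreover have "h d x = 0" using False that(1) by (intro h0) (auto simp: near_def)
    ultimately show ?thesis by (simp add: g_far)
  qed (rule g_near)
  show thesis
  proof
    show "(1 + \<eta>)-lipschitz_on Q g"
    proof (rule lipschitz_onI)
      fix x y assume xy: "x \<in> Q" "y \<in> Q"
      consider (far) "\<nexists>d. near x d" "\<nexists>d. near y d"
        | (one) d where "d \<in> D" "\<And>d'. near x d' \<Longrightarrow> d' = d" "\<And>d'. near y d' \<Longrightarrow> d' = d"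
        | (two) d d' where "near x d" "near y d'" "d \<noteq> d'"
      proof (cases "\<exists>d. near x d")
        case True
        then obtain d where d: "near x d" by blast
        then have "d \<in> D" "\<And>d'. near x d' \<Longrightarrow> d' = d" using near_unique by (auto simp: near_def)
        then show thesis using d one[of d] two[of d] by blast
      next
        case x: False
        show thesis
        proof (cases "\<exists>d. near y d")
          case True
          then obtain d where d: "near y d" by blast
          then have "d \<in> D" "\<And>d'. near y d' \<Longrightarrow> d' = d" using near_unique by (auto simp: near_def)
          then show thesis using x one[of d] by blast
        qed (use x far in blast)
      qed
      then show "dist (g x) (g y) \<le> (1 + \<eta>) * dist x y"
      proof cases
        case far
        have "dist (f x) (f y) \<le> 1 * dist x y" using lipschitz_onD[OF f xy] .
        also have "\<dots> \<le> (1 + \<eta>) * dist x y" using \<open>0 < \<eta>\<close> by (intro mult_right_mono) auto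
        finally show ?thesis using far by (simp add: g_far)
      next
        case one
        then show ?thesis using lipschitz_onD[OF single[OF one(1)] xy] by (simp add: g_only)
      next
        case two
        then have dd: "d \<in> D" "d' \<in> D" "norm (x - d) < R" "norm (y - d') < R"
          by (auto simp: near_def)
        then have "\<sigma> \<le> dist d d'" using D(2) two(3) by (auto simp: pairwise_def)
        also have "\<dots> \<le> dist x d + dist x y + dist y d'" by metric
        finally have "\<sigma> / 2 \<le> dist x y" using dd R by (simp add: dist_norm)
        then have "\<eta> * (\<sigma> / 2) \<le> \<eta> * dist x y" using \<open>0 < \<eta>\<close> by (intro mult_left_mono) auto
        moreover have "4 * R \<le> \<eta> * (\<sigma> / 2)" using R(4) by simp
        ultimately have far_apart: "4 * R \<le> \<eta> * dist x y" by linarith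
        have "dist (f x + h d x) (f y + h d' y) \<le> dist (f x) (f y) + (norm (h d x) + norm (h d' y))"
          using norm_triangle_ineq[of "f x - f y" "h d x - h d' y"] norm_triangle_ineq4[of "h d x" "h d' y"]
          by (simp add: dist_norm algebra_simps)
        also have "\<dots> \<le> 1 * dist x y + (2 * R + 2 * R)"
          using lipschitz_onD[OF f xy] hR[OF dd(1) xy(1)] hR[OF dd(2) xy(2)] by (intro add_mono)
        also have "\<dots> \<le> (1 + \<eta>) * dist x y" using far_apart by (simp add: algebra_simps)
        finally show ?thesis using two by (simp add: g_near)
      qed
    qed (use \<open>0 < \<eta>\<close> in auto)
    show "norm (g x - f x) \<le> \<eta>" if "x \<in> Q" for x
    proof (cases "\<exists>d. near x d")
      case True
      then obtain d where d: "near x d" by blast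
      then show ?thesis using hR[of d x] that R by (simp add: g_near near_def)
    qed (use g_far \<open>0 < \<eta>\<close> in auto)
    show "0 < \<delta>" by fact
    show "g x = f d + L (x - d)" if "d \<in> D" "x \<in> Q" "norm (x - d) \<le> \<delta>" for d x
    proof -
      have "near x d" using that \<delta> by (simp add: near_def)
      then have "g x = f x + h d x" by (rule g_near)
      also have "\<dots> = f d + L (x - d)"
      proof (cases "x = d")
        case False
        then have "log_cutoff c R (norm (x - d)) = 1"
          using that(3) c R by (intro log_cutoff_eq_1) (auto simp: \<delta>_def)
        then show ?thesis by (simp add: h_def affine_corr_def)
      qed (simp add: h_def affine_corr_def)
      finally show ?thesis .
    qed
  qed
qed

section \<open>The space of Lipschitz maps\<close>

lemma norm_diff_le_Lip1_dist:
  assumes "bounded Q" "f \<in> Lip1 Q" "g \<in> Lip1 Q" "x \<in> Q"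
  shows "norm (f x - g x) \<le> Lip1_dist Q f g"
  using cSUP_upper[OF assms(4) Lip1_bdd_above[OF assms(1-3)]] assms
  unfolding Lip1_dist_def by auto

lemma Lip1_dist_le:
  assumes "\<And>x. x \<in> Q \<Longrightarrow> norm (f x - g x) \<le> e" and "0 \<le> e"
  shows "Lip1_dist Q f g \<le> e"
  unfolding Lip1_dist_def using assms by (auto intro: cSUP_least)

lemma lipschitz_on_bounded_norm:
  fixes f :: "'a::metric_space \<Rightarrow> 'b::real_normed_vector"
  assumes "C-lipschitz_on Q f" "bounded Q"
  obtains B where "0 \<le> B" "\<And>x. x \<in> Q \<Longrightarrow> norm (f x) \<le> B"
proof (cases "Q = {}")
  case False
  then obtain a where a: "a \<in> Q" by blast
  obtain b where b: "\<And>x. x \<in> Q \<Longrightarrow> dist a x \<le> b"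
    using assms(2) bounded_any_center[of Q a] by blast
  have "norm (f x) \<le> norm (f a) + C * b" if "x \<in> Q" for x
  proof -
    have "dist (f a) (f x) \<le> C * b"
      using lipschitz_onD[OF assms(1) a that] mult_left_mono[OF b[OF that] lipschitz_on_nonneg[OF assms(1)]]
      by linarith
    then show ?thesis
      using norm_triangle_ineq2[of "f x" "f a"] by (simp add: dist_norm norm_minus_commute)
  qed
  then show thesis using a order_trans norm_ge_zero by (metis that)
qed (use that in auto)

text \<open>
  Shrinking by the factor \<open>1 / (1 + \<eta>)\<close> restores the Lipschitz constant 1. It moves the map by at
  most \<open>\<eta>\<close> times its supremum norm, which is finite because \<open>Q\<close> is bounded, and it replaces \<open>L\<close> by
  \<open>L / (1 + \<eta>)\<close>, which is why the result is only approximately affine with linear part \<open>L\<close>.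
\<close>

lemma Lip1_approx_affine_dense:
  fixes f :: "'a::real_normed_vector \<Rightarrow> 'b::real_normed_vector"
  assumes "bounded Q" "f \<in> Lip1 Q" and L: "norm L \<le> 1"
    and D: "pairwise (\<lambda>x y. \<sigma> \<le> dist x y) D" "\<And>d. d \<in> D \<Longrightarrow> cball d e \<subseteq> Q"
    and "0 < \<sigma>" "0 < e" "0 < \<epsilon>"
  obtains h \<delta> where "h \<in> Lip1 Q" "Lip1_dist Q f h < \<epsilon>" "0 < \<delta>" "\<delta> < e"
    "\<And>d. d \<in> D \<Longrightarrow> approx_affine h L d \<delta> e"
proof -
  have f: "1-lipschitz_on Q f" using assms(2) by (simp add: Lip1_def)
  obtain B where B: "0 \<le> B" "\<And>x. x \<in> Q \<Longrightarrow> norm (f x) \<le> B"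
    using lipschitz_on_bounded_norm[OF f assms(1)] by blast
  define \<eta> where "\<eta> = min e (\<epsilon> / (2 * (1 + B)))"
  have \<eta>: "0 < \<eta>" "\<eta> \<le> e" using B(1) \<open>0 < e\<close> \<open>0 < \<epsilon>\<close> by (auto simp: \<eta>_def)
  have "\<eta> * (1 + B) \<le> \<epsilon> / (2 * (1 + B)) * (1 + B)"
    using B(1) by (intro mult_right_mono) (auto simp: \<eta>_def)
  also have "\<dots> = \<epsilon> / 2" using B(1) by (simp add: divide_simps)
  finally have \<eta>B: "\<eta> * (1 + B) \<le> \<epsilon> / 2" .
  have DQ: "D \<subseteq> Q" using D(2) \<open>0 < e\<close> by force
  obtain g \<delta>\<^sub>0 where g: "(1 + \<eta>)-lipschitz_on Q g" "\<And>x. x \<in> Q \<Longrightarrow> norm (g x - f x) \<le> \<eta>" and "0 < \<delta>\<^sub>0"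
    and aff: "\<And>d x. d \<in> D \<Longrightarrow> x \<in> Q \<Longrightarrow> norm (x - d) \<le> \<delta>\<^sub>0 \<Longrightarrow> g x = f d + blinfun_apply L (x - d)"
    using lipschitz_make_affine_near[OF f L DQ D(1) \<open>0 < \<sigma>\<close> \<eta>(1)] by metis
  define t where "t = inverse (1 + \<eta>)"
  have t: "0 < t" "t * (1 + \<eta>) = 1" "t \<le> 1" "1 - t \<le> \<eta>"
    using \<eta>(1) by (auto simp: t_def field_simps)
  define h where "h = restrict (\<lambda>x. t *\<^sub>R g x) Q"
  define \<delta> where "\<delta> = min \<delta>\<^sub>0 (e / 2)"
  have \<delta>: "0 < \<delta>" "\<delta> < e" "\<delta> \<le> \<delta>\<^sub>0" using \<open>0 < \<delta>\<^sub>0\<close> \<open>0 < e\<close> by (auto simp: \<delta>_def)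
  show thesis
  proof
    have "dist (h x) (h y) \<le> 1 * dist x y" if "x \<in> Q" "y \<in> Q" for x y
    proof -
      have "dist (h x) (h y) = t * dist (g x) (g y)"
        using that t(1) by (simp add: h_def dist_norm flip: scaleR_diff_right)
      also have "\<dots> \<le> t * ((1 + \<eta>) * dist x y)"
        using lipschitz_onD[OF g(1) that] t(1) by (intro mult_left_mono) auto
      also have "\<dots> = 1 * dist x y" using t(2) by (simp flip: mult.assoc)
      finally show ?thesis .
    qed
    then show "h \<in> Lip1 Q" by (auto simp: Lip1_def h_def intro!: lipschitz_onI)
    have "norm (f x - h x) \<le> \<epsilon> / 2" if "x \<in> Q" for x
    proof -
      have "f x - h x = (1 - t) *\<^sub>R f x - t *\<^sub>R (g x - f x)"
        using that by (simp add: h_def algebra_simps)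
      also have "norm \<dots> \<le> (1 - t) * norm (f x) + t * norm (g x - f x)"
        using t norm_triangle_ineq4[of "(1 - t) *\<^sub>R f x" "t *\<^sub>R (g x - f x)"] by simp
      also have "\<dots> \<le> \<eta> * B + 1 * \<eta>"
        using t B g(2) that \<eta>(1) by (intro add_mono mult_mono) auto
      finally show ?thesis using \<eta>B by (simp add: algebra_simps)
    qed
    then have "Lip1_dist Q f h \<le> \<epsilon> / 2" using \<open>0 < \<epsilon>\<close> by (intro Lip1_dist_le) auto
    then show "Lip1_dist Q f h < \<epsilon>" using \<open>0 < \<epsilon>\<close> by simp
    show "0 < \<delta>" "\<delta> < e" by fact+
    fix d assume d: "d \<in> D"
    show "approx_affine h L d \<delta> e"
      unfolding approx_affine_def
    proof (intro allI impI)
      fix u :: 'a assume u: "norm u \<le> \<delta>"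
      have Q: "d + u \<in> Q" "d \<in> Q" using D(2)[OF d] u \<delta> by (auto simp: dist_norm subset_iff)
      have "g (d + u) = f d + L u" "g d = f d"
        using aff[OF d Q(1)] aff[OF d Q(2)] u \<delta> by auto
      then have "h (d + u) - h d - L u = - ((1 - t) *\<^sub>R L u)"
        using Q by (simp add: h_def algebra_simps)
      then have "norm (h (d + u) - h d - L u) = (1 - t) * norm (L u)"
        using t by (simp add: abs_of_nonneg)
      also have "\<dots> \<le> e * (1 * \<delta>)"
        using t \<eta> \<open>0 < e\<close> L u by (intro mult_mono order_trans[OF norm_blinfun]) auto
      finally show "norm (h (d + u) - h d - L u) \<le> e * \<delta>" by simp
    qed
  qed
qed

text \<open>
  The maps that are nearly affine at some common scale \<open>\<delta>\<close> at every point of \<open>D\<close>, enlarged by balls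
  whose radius \<open>e * \<delta>\<close> is comparable to the permitted error: this makes the set open by
  construction and costs only the factor 3 in \<open>affine_on_scaleD\<close>.
\<close>

definition affine_on_scale ::
    "'a::real_normed_vector set \<Rightarrow> 'a set \<Rightarrow> ('a \<Rightarrow>\<^sub>L 'b::real_normed_vector) \<Rightarrow> real \<Rightarrow> ('a \<Rightarrow> 'b) set"
  where "affine_on_scale Q D L e =
    \<Union>{Metric_space.mball (Lip1 Q) (Lip1_dist Q) h (e * \<delta>) | h \<delta>.
         h \<in> Lip1 Q \<and> 0 < \<delta> \<and> \<delta> < e \<and> (\<forall>d\<in>D. approx_affine h L d \<delta> e)}"

lemma openin_affine_on_scale:
  assumes "bounded Q"
  shows "openin (Lip1_topology Q) (affine_on_scale Q D L e)"
proof -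
  interpret Metric_space "Lip1 Q :: ('a \<Rightarrow> 'b) set" "Lip1_dist Q"
    using assms by (rule Metric_space_Lip1)
  show ?thesis
    unfolding affine_on_scale_def Lip1_topology_def by (rule openin_Union) auto
qed

lemma topspace_Lip1_topology:
  assumes "bounded Q"
  shows "topspace (Lip1_topology Q :: ('a::real_normed_vector \<Rightarrow> 'b::real_normed_vector) topology) = Lip1 Q"
proof -
  interpret Metric_space "Lip1 Q :: ('a \<Rightarrow> 'b) set" "Lip1_dist Q"
    using assms by (rule Metric_space_Lip1)
  show ?thesis by (simp add: Lip1_topology_def)
qed

lemma affine_on_scale_dense:
  fixes L :: "'a::real_normed_vector \<Rightarrow>\<^sub>L 'b::real_normed_vector"
  assumes "bounded Q" "norm L \<le> 1"
    and D: "pairwise (\<lambda>x y. \<sigma> \<le> dist x y) D" "\<And>d. d \<in> D \<Longrightarrow> cball d e \<subseteq> Q"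
    and "0 < \<sigma>" "0 < e"
  shows "Lip1_topology Q closure_of affine_on_scale Q D L e = topspace (Lip1_topology Q)"
proof -
  interpret Metric_space "Lip1 Q :: ('a \<Rightarrow> 'b) set" "Lip1_dist Q"
    using assms(1) by (rule Metric_space_Lip1)
  have "\<exists>h\<in>affine_on_scale Q D L e. h \<in> mball f \<epsilon>" if f: "f \<in> Lip1 Q" "0 < \<epsilon>" for f \<epsilon>
  proof -
    obtain h \<delta> where h: "h \<in> Lip1 Q" "Lip1_dist Q f h < \<epsilon>" "0 < \<delta>" "\<delta> < e"
        "\<And>d. d \<in> D \<Longrightarrow> approx_affine h L d \<delta> e"
      using Lip1_approx_affine_dense[OF assms(1) f(1) assms(2) D \<open>0 < \<sigma>\<close> \<open>0 < e\<close> f(2)] by metis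
    have "h \<in> mball h (e * \<delta>)" using h \<open>0 < e\<close> by simp
    then have "h \<in> affine_on_scale Q D L e" unfolding affine_on_scale_def using h by blast
    then show ?thesis using h f by auto
  qed
  then show ?thesis
    unfolding Lip1_topology_def metric_closure_of by auto
qed

lemma affine_on_scaleD:
  fixes f :: "'a::real_normed_vector \<Rightarrow> 'b::real_normed_vector"
  assumes "bounded Q" "f \<in> affine_on_scale Q D L e" and D: "\<And>d. d \<in> D \<Longrightarrow> cball d e \<subseteq> Q"
  obtains \<delta> where "0 < \<delta>" "\<delta> < e" "\<And>d. d \<in> D \<Longrightarrow> approx_affine f L d \<delta> (3 * e)"
proof -
  interpret Metric_space "Lip1 Q :: ('a \<Rightarrow> 'b) set" "Lip1_dist Q"
    using assms(1) by (rule Metric_space_Lip1)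
  obtain h \<delta> where h: "h \<in> Lip1 Q" "0 < \<delta>" "\<delta> < e" "\<And>d. d \<in> D \<Longrightarrow> approx_affine h L d \<delta> e"
      and "f \<in> mball h (e * \<delta>)"
    using assms(2) unfolding affine_on_scale_def by blast
  then have f: "f \<in> Lip1 Q" "Lip1_dist Q h f < e * \<delta>" by auto
  have "approx_affine f L d \<delta> (3 * e)" if "d \<in> D" for d
  proof (rule approx_affine_perturb)
    show "approx_affine h L d \<delta> e" using h(4) that .
    fix z assume "z \<in> cball d \<delta>"
    then have "z \<in> Q" using D[OF that] h(3) by (auto simp: subset_iff)
    then show "norm (h z - f z) \<le> e * \<delta>"
      using norm_diff_le_Lip1_dist[OF assms(1) h(1) f(1)] f(2) by (meson less_imp_le order_trans)
  qed (rule h(2))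
  then show thesis using that h by blast
qed

section \<open>Typical points of a typical map\<close>

theorem theorem1p1:
  fixes W :: "('a::banach \<Rightarrow>\<^sub>L 'b::banach) set"
    and Q G :: "'a set"
  assumes "subspace W"
    and "separable_space (top_of_set W)"
    and "closed Q"
    and "bounded Q"
    and "G \<subseteq> interior Q"
  shows "\<exists>\<F> :: ('a \<Rightarrow> 'b) set.
           residual_in (Lip1_topology Q) \<F> \<and>
           (\<forall>f\<in>\<F>. residual_in (top_of_set G) (N_set G f W))"
proof -
  obtain S where S: "countable S" "S \<subseteq> {L \<in> W. norm L \<le> 1}"
    and S_dense: "\<And>L e. L \<in> {L \<in> W. norm L \<le> 1} \<Longrightarrow> 0 < e \<Longrightarrow> \<exists>L'\<in>S. dist L L' < e"
    using separable_space_countable_dense_subset[OF assms(2), of "{L \<in> W. norm L \<le> 1}"] by blast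
  \<comment> \<open>One sequence serves as separation constants, as distances to the complement of \<open>Q\<close>, and as errors.\<close>
  define \<sigma> where "\<sigma> m = inverse (real (Suc m))" for m
  have \<sigma>_pos: "0 < \<sigma> m" for m by (simp add: \<sigma>_def)
  have \<sigma>_mono: "\<sigma> n \<le> \<sigma> m" if "m \<le> n" for m n
    using that by (auto simp: \<sigma>_def intro: le_imp_inverse_le)
  have \<sigma>_small: "\<exists>m. \<sigma> m < e" if "0 < e" for e
    using reals_Archimedean[OF that] by (simp add: \<sigma>_def)
  have "\<forall>m. \<exists>D. D \<subseteq> {x \<in> G. cball x (\<sigma> m) \<subseteq> Q} \<and> pairwise (\<lambda>x y. \<sigma> m \<le> dist x y) D \<and>
      (\<forall>x\<in>{x \<in> G. cball x (\<sigma> m) \<subseteq> Q}. \<exists>d\<in>D. dist x d < \<sigma> m)" (is "\<forall>m. \<exists>D. ?P m D")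
  proof
    fix m
    show "\<exists>D. ?P m D"
    proof (rule maximal_separated_subset[OF \<sigma>_pos[of m], of "{x \<in> G. cball x (\<sigma> m) \<subseteq> Q}"])
      fix D assume "D \<subseteq> {x \<in> G. cball x (\<sigma> m) \<subseteq> Q}" "pairwise (\<lambda>x y. \<sigma> m \<le> dist x y) D"
        "\<And>x. x \<in> {x \<in> G. cball x (\<sigma> m) \<subseteq> Q} \<Longrightarrow> \<exists>d\<in>D. dist x d < \<sigma> m"
      then show ?thesis by (intro exI[of _ D] conjI ballI)
    qed
  qed
  from choice[OF this] obtain D where "\<forall>m. ?P m (D m)" by (rule exE)
  then have D: "\<And>m. D m \<subseteq> {x \<in> G. cball x (\<sigma> m) \<subseteq> Q}"
      "\<And>m. pairwise (\<lambda>x y. \<sigma> m \<le> dist x y) (D m)"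
      "\<And>m x. x \<in> G \<Longrightarrow> cball x (\<sigma> m) \<subseteq> Q \<Longrightarrow> \<exists>d\<in>D m. dist x d < \<sigma> m"
    by simp_all
  have D_dense: "\<exists>m. \<exists>d\<in>D m. dist x d < e" if "x \<in> G" "0 < e" for x e
  proof -
    obtain r where r: "0 < r" "cball x r \<subseteq> Q"
      using \<open>x \<in> G\<close> assms(5) mem_interior_cball by blast
    obtain m where m: "\<sigma> m < min r e" using \<sigma>_small[of "min r e"] r(1) \<open>0 < e\<close> by auto
    then have "cball x (\<sigma> m) \<subseteq> Q" using r(2) subset_cball[of "\<sigma> m" r x] by auto
    from D(3)[OF that(1) this] obtain d where "d \<in> D m" "dist x d < \<sigma> m" by blast
    then show ?thesis using m by (intro exI[of _ m] bexI[of _ d]) auto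
  qed
  have DQ: "cball d (\<sigma> (m + k)) \<subseteq> Q" if "d \<in> D m" for d m k
    using D(1)[of m] that subset_cball[OF \<sigma>_mono[of m "m + k"], of d] by auto
  \<comment> \<open>The index \<open>m + k\<close> makes the scale small enough both to stay inside \<open>Q\<close> around \<open>D m\<close> and for an error \<open>\<sigma> k\<close>.\<close>
  define \<U> where "\<U> = (\<lambda>(m, k, L). affine_on_scale Q (D m) L (\<sigma> (m + k))) ` (UNIV \<times> UNIV \<times> S)"
  define \<F> where "\<F> = Lip1 Q \<inter> \<Inter>\<U>"
  have "residual_in (Lip1_topology Q) \<F>"
  proof (rule residual_inI)
    show "countable \<U>" using S(1) by (simp add: \<U>_def)
    show "openin (Lip1_topology Q) U" if "U \<in> \<U>" for U
      using that openin_affine_on_scale[OF assms(4)] by (auto simp: \<U>_def)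
    show "Lip1_topology Q closure_of U = topspace (Lip1_topology Q)" if "U \<in> \<U>" for U
    proof -
      obtain m k L where U: "U = affine_on_scale Q (D m) L (\<sigma> (m + k))" and "L \<in> S"
        using \<open>U \<in> \<U>\<close> by (auto simp: \<U>_def)
      show ?thesis
        unfolding U using S(2) \<open>L \<in> S\<close>
        by (intro affine_on_scale_dense[OF assms(4) _ D(2) DQ \<sigma>_pos \<sigma>_pos]) auto
    qed
  qed (use assms(4) in \<open>auto simp: \<F>_def topspace_Lip1_topology\<close>)
  moreover have "residual_in (top_of_set G) (N_set G f W)" if "f \<in> \<F>" for f
  proof -
    \<comment> \<open>The radius \<open>\<delta> / 2\<close> is the largest one for which \<open>approx_affine_shift\<close> moves the estimate from the centre to the whole ball.\<close>
    define V where "V k L =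
      \<Union>{ball d (\<delta> / 2) | d \<delta>. 0 < \<delta> \<and> \<delta> < \<sigma> k \<and> approx_affine f L d \<delta> (3 * \<sigma> k)}" for k L
    define \<V> where "\<V> = (\<lambda>(k, L). G \<inter> V k L) ` (UNIV \<times> S)"
    have D_V: "D m \<subseteq> V k L" if "L \<in> S" for m k L
    proof
      fix d assume d: "d \<in> D m"
      have "f \<in> affine_on_scale Q (D m) L (\<sigma> (m + k))"
        using \<open>f \<in> \<F>\<close> \<open>L \<in> S\<close> by (auto simp: \<F>_def \<U>_def)
      then obtain \<delta> where \<delta>: "0 < \<delta>" "\<delta> < \<sigma> (m + k)" "approx_affine f L d \<delta> (3 * \<sigma> (m + k))"
        using affine_on_scaleD[OF assms(4) _ DQ] d by metis
      have le: "\<sigma> (m + k) \<le> \<sigma> k" by (rule \<sigma>_mono) simp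
      have "approx_affine f L d \<delta> (3 * \<sigma> k)"
        using \<delta>(1) le by (intro approx_affine_mono[OF \<delta>(3)]) auto
      moreover have "\<delta> < \<sigma> k" using \<delta>(2) le by simp
      moreover have "d \<in> ball d (\<delta> / 2)" using \<delta>(1) by simp
      ultimately show "d \<in> V k L" unfolding V_def using \<delta>(1) by blast
    qed
    show ?thesis
    proof (rule residual_inI)
      show "countable \<V>" using S(1) by (simp add: \<V>_def)
      show "openin (top_of_set G) U" if "U \<in> \<V>" for U
      proof -
        have "open (V k L)" for k L unfolding V_def by (rule open_Union) auto
        moreover obtain k L where "U = G \<inter> V k L" using \<open>U \<in> \<V>\<close> by (auto simp: \<V>_def)
        ultimately show ?thesis by (simp add: openin_open_Int)
      qed
      show "top_of_set G closure_of U = topspace (top_of_set G)" if "U \<in> \<V>" for U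
      proof -
        obtain k L where U: "U = G \<inter> V k L" and "L \<in> S" using \<open>U \<in> \<V>\<close> by (auto simp: \<V>_def)
        have "x \<in> closure U" if x: "x \<in> G" for x
          unfolding closure_approachable
        proof (intro allI impI)
          fix e :: real assume "0 < e"
          then obtain m d where "d \<in> D m" "dist x d < e" using D_dense[OF x] by blast
          moreover have "d \<in> U"
            using D_V[OF \<open>L \<in> S\<close>, of m k] D(1)[of m] \<open>d \<in> D m\<close> by (auto simp: U)
          ultimately show "\<exists>y\<in>U. dist y x < e" by (auto simp: dist_commute)
        qed
        moreover have "U \<subseteq> G" by (simp add: U)
        ultimately have "G \<inter> closure U = G" by blast
        with \<open>U \<subseteq> G\<close> show ?thesis
          by (simp only: closure_of_subtopology Int_absorb1 euclidean_closure_of topspace_euclidean_subtopology)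
      qed
      show "N_set G f W \<subseteq> topspace (top_of_set G)" by (auto simp: N_set_def)
      have "L \<in> diff_ops f x" if xL: "x \<in> G" "x \<in> \<Inter>\<V>" "L \<in> W" "norm L \<le> 1" for x L
      proof (rule diff_opsI)
        \<comment> \<open>The constant \<open>24\<close> is \<open>3 * 4 * 2\<close>: the losses in passing to \<open>f\<close>, to \<open>x\<close>, and to \<open>L\<close>.\<close>
        fix \<epsilon> :: real assume "0 < \<epsilon>"
        then obtain k where k: "\<sigma> k < \<epsilon> / 24" using \<sigma>_small[of "\<epsilon> / 24"] by auto
        obtain L' where L': "L' \<in> S" "dist L L' < 12 * \<sigma> k"
          using S_dense[of L "12 * \<sigma> k"] xL \<sigma>_pos[of k] by auto
        have "x \<in> V k L'" using xL(2) L'(1) by (auto simp: \<V>_def)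
        then obtain d \<delta> where d: "x \<in> ball d (\<delta> / 2)" "0 < \<delta>" "\<delta> < \<sigma> k"
            "approx_affine f L' d \<delta> (3 * \<sigma> k)"
          unfolding V_def by auto
        have "approx_affine f L' x (\<delta> / 2) (12 * \<sigma> k)"
          using approx_affine_shift[OF d(4), of x] d(1) by (simp add: dist_norm norm_minus_commute)
        then have "approx_affine f L x (\<delta> / 2) (24 * \<sigma> k)"
          using approx_affine_change_operator[of f L' x "\<delta> / 2" "12 * \<sigma> k" L] L'(2)
          by (simp add: dist_norm norm_minus_commute)
        then have "approx_affine f L x (\<delta> / 2) \<epsilon>"
          using k d(2) by (elim approx_affine_mono) auto
        then show "\<exists>r. 0 < r \<and> r < \<epsilon> \<and> approx_affine f L x r \<epsilon>"
          using d k \<open>0 < \<epsilon>\<close> by (intro exI[of _ "\<delta> / 2"]) auto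
      qed
      then show "topspace (top_of_set G) \<inter> \<Inter>\<V> \<subseteq> N_set G f W" by (auto simp: N_set_def)
    qed
  qed
  ultimately show ?thesis by blast
qed

end
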